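(* Let $f:X\to X$ be a minimal homeomorphism of an infinite compact metric space $X$. Then $f$ is not topologically $GH$-stable.
   Context: A homeomorphism $f:X\to X$ of a compact metric space is minimal if the only nonempty closed $f$-invariant subset of $X$ is $X$ itself (equivalently, every orbit is dense). Hausdorff distance: for nonempty subsets $A,B$ of a metric space $(X,d)$, $d_H(A,B)=\max\{\sup_{a\in A}\inf_{b\in B}d(a,b),\ \sup_{b\in B}\inf_{a\in A}d(a,b)\}$. $\Delta$-isometry: for compact metric spaces $(X,d^X)$, $(Y,d^Y)$ and $\Delta>0$, a map (not necessarily continuous) $i:X\to Y$ is a $\Delta$-isometry if $\max\{d_H(i(X),Y),\ \sup_{x,x'\in X}|d^Y(i(x),i(x'))-d^X(x,x')|\}<\Delta$. Uniform distance: for (not necessarily continuous) maps $u,v:Z\to W$ between metric spaces, $d_{C^0}(u,v)=\sup_{z\in Z}d^W(u(z),v(z))$. $C^0$-Gromov--Hausdorff distance: for continuous maps $f:X\to X$ and $g:Y\to Y$ of compact metric spaces, $d_{GH^0}(f,g)$ is the infimum of all $\Delta>0$ for which there exist $\Delta$-isometries $i:X\to Y$ and $j:Y\to X$ such that $d_{C^0}(g\circ i,i\circ f)<\Delta$ and $d_{C^0}(j\circ g,f\circ j)<\Delta$. Topological $GH$-stability: a homeomorphism $f:X\to X$ of a compact metric space is topologically $GH$-stable if for every $\varepsilon>0$ there exists $\eta>0$ such that for every homeomorphism $g:Y\to Y$ of a compact metric space with $d_{GH^0}(f,g)<\eta$ there exists a continuous $\varepsilon$-isometry $h:Y\to X$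 with $f\circ h=h\circ g$. *)

theory Defs
  imports "HOL-Analysis.Analysis"
begin

(* Metric spaces are values of the library type 'a metric (carrier mspace, distance mdist), so that
   one definition can speak about several spaces.  Maps are total functions of which only the
   values on the carrier matter. *)

definition homeomorphism_of :: "'a metric \<Rightarrow> ('a \<Rightarrow> 'a) \<Rightarrow> bool" where
  "homeomorphism_of X f \<longleftrightarrow> homeomorphic_map (mtopology_of X) (mtopology_of X) f"

(* For a homeomorphism, A is called invariant when f ` A = A.  On a compact space the resulting
   notion of minimality is the same if only f ` A \<subseteq> A is required. *)
definition minimal_map :: "'a metric \<Rightarrow> ('a \<Rightarrow> 'a) \<Rightarrow> bool" where
  "minimal_map X f \<longleftrightarrow>
     (\<forall>A. closedin (mtopology_of X) A \<and> A \<noteq> {} \<and> f ` A = A \<longrightarrow> A = mspace X)"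

(* The suprema and infima below are taken in the reals; for nonempty compact spaces, the only ones
   they are used for, every family involved is nonempty and bounded. *)

definition Hausdorff_dist :: "'a metric \<Rightarrow> 'a set \<Rightarrow> 'a set \<Rightarrow> real" where
  "Hausdorff_dist X A B =
     max (SUP a\<in>A. INF b\<in>B. mdist X a b) (SUP b\<in>B. INF a\<in>A. mdist X a b)"

definition delta_isometry :: "real \<Rightarrow> 'a metric \<Rightarrow> 'b metric \<Rightarrow> ('a \<Rightarrow> 'b) \<Rightarrow> bool" where
  "delta_isometry \<Delta> X Y i \<longleftrightarrow>
     i \<in> mspace X \<rightarrow> mspace Y \<and>
     max (Hausdorff_dist Y (i ` mspace X) (mspace Y))
         (SUP (x, x') \<in> mspace X \<times> mspace X. \<bar>mdist Y (i x) (i x') - mdist X x x'\<bar>) < \<Delta>"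

definition uniform_dist :: "'a metric \<Rightarrow> 'b metric \<Rightarrow> ('a \<Rightarrow> 'b) \<Rightarrow> ('a \<Rightarrow> 'b) \<Rightarrow> real" where
  "uniform_dist Z W u v = (SUP z\<in>mspace Z. mdist W (u z) (v z))"

definition GH0_dist ::
  "'a metric \<Rightarrow> 'b metric \<Rightarrow> ('a \<Rightarrow> 'a) \<Rightarrow> ('b \<Rightarrow> 'b) \<Rightarrow> real" where
  "GH0_dist X Y f g =
     Inf {\<Delta>. \<Delta> > 0 \<and>
       (\<exists>i j. delta_isometry \<Delta> X Y i \<and> delta_isometry \<Delta> Y X j \<and>
              uniform_dist X Y (g \<circ> i) (i \<circ> f) < \<Delta> \<and>
              uniform_dist Y X (j \<circ> g) (f \<circ> j) < \<Delta>)}"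

(* Y has to range over all compact metric spaces, and HOL cannot quantify over types inside a
   formula.  A compact metric space has at most continuum many points, so it is isometric to a
   space (with an arbitrary metric) whose carrier is a set of reals; the theorem
   topologically_GH_stable_any_type below shows that nothing is lost.
   Y is nonempty: otherwise there is no map from X to Y, and the distance would be infinite. *)
definition topologically_GH_stable :: "'a metric \<Rightarrow> ('a \<Rightarrow> 'a) \<Rightarrow> bool" where
  "topologically_GH_stable X f \<longleftrightarrow>
     (\<forall>\<epsilon>>0. \<exists>\<eta>>0. \<forall>(Y :: real metric) g.
        compact_space (mtopology_of Y) \<and> mspace Y \<noteq> {} \<and> homeomorphism_of Y g \<and>
        GH0_dist X Y f g < \<eta> \<longrightarrow>
        (\<exists>h. continuous_map (mtopology_of Y) (mtopology_of X) h \<and> delta_isometry \<epsilon> Y X h \<and>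
             (\<forall>y\<in>mspace Y. f (h y) = h (g y))))"

lemma compact_metric_lepoll_reals:
  fixes Y :: "'a metric"
  assumes "compact_space (mtopology_of Y)"
  shows "mspace Y \<lesssim> (UNIV :: real set)"
proof -
  interpret Metric_space "mspace Y" "mdist Y" by (rule Metric_space_mspace_mdist)
  have "mtotally_bounded (mspace Y)"
    using assms compactin_imp_mtotally_bounded
    by (metis compact_space_def mtopology_of_def topspace_mtopology_of)
  then have "\<exists>K. finite K \<and> K \<subseteq> mspace Y \<and> mspace Y \<subseteq> (\<Union>x\<in>K. mball x (1 / Suc n))" for n
    unfolding mtotally_bounded_def by (simp del: of_nat_Suc)
  then obtain K where K: "\<And>n. finite (K n)" "\<And>n. K n \<subseteq> mspace Y"
      "\<And>n. mspace Y \<subseteq> (\<Union>x\<in>K n. mball x (1 / Suc n))"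
    by metis
  define D where "D = (\<Union>n. K n) \<times> (UNIV :: nat set)"
  have cD: "countable D"
    unfolding D_def using K(1) by (intro countable_SIGMA countable_UN) (auto simp: countable_finite)
  define F where "F = (\<lambda>y. to_nat_on D ` {p \<in> D. y \<in> mball (fst p) (1 / Suc (snd p))})"
  have "inj_on F (mspace Y)"
  proof (rule inj_onI, rule ccontr)
    fix x y assume xy: "x \<in> mspace Y" "y \<in> mspace Y" "F x = F y" "x \<noteq> y"
    then have "mdist Y x y / 2 > 0" by simp
    then obtain n where n: "1 / real (Suc n) < mdist Y x y / 2"
      using nat_approx_posE by metis
    obtain k where k: "k \<in> K n" "x \<in> mball k (1 / Suc n)" using K(3) xy(1) by blast
    have "inj_on (to_nat_on D) D" using cD by (rule inj_on_to_nat_on)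
    then have "{p \<in> D. x \<in> mball (fst p) (1 / Suc (snd p))}
             = {p \<in> D. y \<in> mball (fst p) (1 / Suc (snd p))}"
      by (rule inj_on_image_eq_iff[THEN iffD1, OF _ _ _ xy(3)[unfolded F_def]]) auto
    moreover have "(k, n) \<in> {p \<in> D. x \<in> mball (fst p) (1 / Suc (snd p))}"
      using k by (auto simp: D_def)
    ultimately have "y \<in> mball k (1 / Suc n)" by simp
    with k xy n triangle[of x k y] commute[of x k] show False by auto
  qed
  then have "mspace Y \<lesssim> (UNIV :: nat set set)"
    unfolding lepoll_def by blast
  then show ?thesis
    using nat_sets_eqpoll_reals lepoll_trans1 lepoll_trans2 by blast
qed

lemma GH0_dist_isometric_le_aux:
  fixes X :: "'a metric" and Y :: "'b metric" and Y' :: "'c metric"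
  assumes e: "e ` mspace Y = mspace Y'" and p: "p ` mspace Y' = mspace Y"
    and d: "\<And>x y. x \<in> mspace Y \<Longrightarrow> y \<in> mspace Y \<Longrightarrow> mdist Y' (e x) (e y) = mdist Y x y"
    and d': "\<And>x y. x \<in> mspace Y' \<Longrightarrow> y \<in> mspace Y' \<Longrightarrow> mdist Y (p x) (p y) = mdist Y' x y"
    and pe: "\<And>y. y \<in> mspace Y \<Longrightarrow> p (e y) = y"
    and g: "g \<in> mspace Y \<rightarrow> mspace Y" and g': "\<And>y. y \<in> mspace Y' \<Longrightarrow> g' y = e (g (p y))"
    and f: "f \<in> mspace X \<rightarrow> mspace X"
    and i: "delta_isometry \<Delta> X Y i" and j: "delta_isometry \<Delta> Y X j"
    and gi: "uniform_dist X Y (g \<circ> i) (i \<circ> f) < \<Delta>"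
    and jg: "uniform_dist Y X (j \<circ> g) (f \<circ> j) < \<Delta>"
  shows "delta_isometry \<Delta> X Y' (e \<circ> i) \<and> delta_isometry \<Delta> Y' X (j \<circ> p) \<and>
         uniform_dist X Y' (g' \<circ> (e \<circ> i)) ((e \<circ> i) \<circ> f) < \<Delta> \<and>
         uniform_dist Y' X ((j \<circ> p) \<circ> g') (f \<circ> (j \<circ> p)) < \<Delta>"
proof -
  have im: "i \<in> mspace X \<rightarrow> mspace Y" and jm: "j \<in> mspace Y \<rightarrow> mspace X"
    using i j by (auto simp: delta_isometry_def)
  have em: "e y \<in> mspace Y'" if "y \<in> mspace Y" for y using e that by blast
  have pm: "p y \<in> mspace Y" if "y \<in> mspace Y'" for y using p that by blast
  have H: "Hausdorff_dist Y' ((e \<circ> i) ` mspace X) (mspace Y')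
         = Hausdorff_dist Y (i ` mspace X) (mspace Y)"
    unfolding Hausdorff_dist_def e[symmetric] image_comp[symmetric] image_image
    using im d
    by (intro arg_cong2[where f = max] SUP_cong INF_cong refl) (auto simp: Pi_iff)
  have S: "(SUP (x, x') \<in> mspace X \<times> mspace X. \<bar>mdist Y' ((e \<circ> i) x) ((e \<circ> i) x') - mdist X x x'\<bar>)
         = (SUP (x, x') \<in> mspace X \<times> mspace X. \<bar>mdist Y (i x) (i x') - mdist X x x'\<bar>)"
    using im d by (intro SUP_cong refl) (auto simp: Pi_iff)
  have 1: "delta_isometry \<Delta> X Y' (e \<circ> i)"
    using i em[OF funcset_mem[OF im]] unfolding delta_isometry_def H S by auto
  have jp: "(j \<circ> p) ` mspace Y' = j ` mspace Y"
    using p by (metis image_comp)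
  have pp: "mspace Y \<times> mspace Y = map_prod p p ` (mspace Y' \<times> mspace Y')"
    using p map_prod_surj_on by blast
  have S': "(SUP (x, x') \<in> mspace Y' \<times> mspace Y'. \<bar>mdist X ((j \<circ> p) x) ((j \<circ> p) x') - mdist Y' x x'\<bar>)
         = (SUP (x, x') \<in> mspace Y \<times> mspace Y. \<bar>mdist X (j x) (j x') - mdist Y x x'\<bar>)"
    unfolding pp image_image using d' by (intro SUP_cong refl) auto
  have 2: "delta_isometry \<Delta> Y' X (j \<circ> p)"
    using j jm pm unfolding delta_isometry_def jp S' by auto
  have 3: "uniform_dist X Y' (g' \<circ> (e \<circ> i)) ((e \<circ> i) \<circ> f) = uniform_dist X Y (g \<circ> i) (i \<circ> f)"
    unfolding uniform_dist_def
  proof (intro SUP_cong refl)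
    fix z assume "z \<in> mspace X"
    then have "i z \<in> mspace Y" "i (f z) \<in> mspace Y" using im f by auto
    moreover from this have "g (i z) \<in> mspace Y" using g by auto
    ultimately show "mdist Y' ((g' \<circ> (e \<circ> i)) z) ((e \<circ> i \<circ> f) z) = mdist Y ((g \<circ> i) z) ((i \<circ> f) z)"
      using g' em pe d by simp
  qed
  have "uniform_dist Y X (j \<circ> g) (f \<circ> j) = (SUP z\<in>p ` mspace Y'. mdist X ((j \<circ> g) z) ((f \<circ> j) z))"
    unfolding uniform_dist_def p ..
  also have "\<dots> = uniform_dist Y' X ((j \<circ> p) \<circ> g') (f \<circ> (j \<circ> p))"
    unfolding uniform_dist_def image_image
  proof (intro SUP_cong refl)
    fix z assume "z \<in> mspace Y'"
    moreover from this have "g (p z) \<in> mspace Y" using g pm by auto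
    ultimately show "mdist X ((j \<circ> g) (p z)) ((f \<circ> j) (p z)) = mdist X ((j \<circ> p \<circ> g') z) ((f \<circ> (j \<circ> p)) z)"
      using g' pe by simp
  qed
  finally show ?thesis using 1 2 3 gi jg by simp
qed

lemma GH0_dist_isometric:
  fixes X :: "'a metric" and Y :: "'b metric" and Y' :: "'c metric"
  assumes e: "e ` mspace Y = mspace Y'" and p: "p ` mspace Y' = mspace Y"
    and d: "\<And>x y. x \<in> mspace Y \<Longrightarrow> y \<in> mspace Y \<Longrightarrow> mdist Y' (e x) (e y) = mdist Y x y"
    and pe: "\<And>y. y \<in> mspace Y \<Longrightarrow> p (e y) = y"
    and g: "g \<in> mspace Y \<rightarrow> mspace Y" and f: "f \<in> mspace X \<rightarrow> mspace X"
  shows "GH0_dist X Y' f (e \<circ> g \<circ> p) = GH0_dist X Y f g"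
proof -
  have ep: "e (p y) = y" if "y \<in> mspace Y'" for y using e pe that by force
  have pm: "p y \<in> mspace Y" if "y \<in> mspace Y'" for y using p that by blast
  have d': "mdist Y (p x) (p y) = mdist Y' x y" if "x \<in> mspace Y'" "y \<in> mspace Y'" for x y
    using d[of "p x" "p y"] ep pm that by simp
  have g': "e \<circ> g \<circ> p \<in> mspace Y' \<rightarrow> mspace Y'"
  proof
    fix y assume "y \<in> mspace Y'"
    then have "g (p y) \<in> mspace Y" using pm g by blast
    then show "(e \<circ> g \<circ> p) y \<in> mspace Y'" unfolding e[symmetric] by simp
  qed
  have g'': "g y = p ((e \<circ> g \<circ> p) (e y))" if "y \<in> mspace Y" for y
  proof -
    have "g y \<in> mspace Y" using g that by auto
    then show ?thesis using that pe by simp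
  qed
  show ?thesis
    unfolding GH0_dist_def
  proof (rule arg_cong[where f = Inf], rule Collect_cong, rule conj_cong[OF refl], rule iffI,
      goal_cases)
    case (1 \<Delta>)
    then obtain i j where "delta_isometry \<Delta> X Y' i" "delta_isometry \<Delta> Y' X j"
        "uniform_dist X Y' ((e \<circ> g \<circ> p) \<circ> i) (i \<circ> f) < \<Delta>"
        "uniform_dist Y' X (j \<circ> (e \<circ> g \<circ> p)) (f \<circ> j) < \<Delta>" by metis
    note ij = this
    show ?case
      by (rule exI[of _ "p \<circ> i"], rule exI[of _ "j \<circ> e"],
          rule GH0_dist_isometric_le_aux[where g = "e \<circ> g \<circ> p", OF p e _ _ _ _ _ f ij])
        (assumption | rule d d' ep g' g'')+
  next
    case (2 \<Delta>)
    then obtain i j where "delta_isometry \<Delta> X Y i" "delta_isometry \<Delta> Y X j"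
        "uniform_dist X Y (g \<circ> i) (i \<circ> f) < \<Delta>"
        "uniform_dist Y X (j \<circ> g) (f \<circ> j) < \<Delta>" by metis
    note ij = this
    show ?case
      by (rule exI[of _ "e \<circ> i"], rule exI[of _ "j \<circ> p"],
          rule GH0_dist_isometric_le_aux[where g = g, OF e p _ _ _ _ _ f ij])
        (assumption | rule d d' pe g comp_apply | simp)+
  qed
qed

theorem topologically_GH_stable_any_type:
  fixes X :: "'a metric" and f :: "'a \<Rightarrow> 'a"
  assumes "topologically_GH_stable X f" and f: "f \<in> mspace X \<rightarrow> mspace X" and "\<epsilon> > 0"
  shows "\<exists>\<eta>>0. \<forall>(Y :: 'b metric) g.
        compact_space (mtopology_of Y) \<and> mspace Y \<noteq> {} \<and> homeomorphism_of Y g \<and>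
        GH0_dist X Y f g < \<eta> \<longrightarrow>
        (\<exists>h. continuous_map (mtopology_of Y) (mtopology_of X) h \<and> delta_isometry \<epsilon> Y X h \<and>
             (\<forall>y\<in>mspace Y. f (h y) = h (g y)))"
proof -
  obtain \<eta> where "\<eta> > 0" and \<eta>: "\<And>(Y :: real metric) g.
        compact_space (mtopology_of Y) \<Longrightarrow> mspace Y \<noteq> {} \<Longrightarrow> homeomorphism_of Y g \<Longrightarrow>
        GH0_dist X Y f g < \<eta> \<Longrightarrow>
        (\<exists>h. continuous_map (mtopology_of Y) (mtopology_of X) h \<and> delta_isometry \<epsilon> Y X h \<and>
             (\<forall>y\<in>mspace Y. f (h y) = h (g y)))"
    using assms unfolding topologically_GH_stable_def by metis
  show ?thesis
  proof (intro exI[of _ \<eta>] conjI allI impI \<open>\<eta> > 0\<close>)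
    fix Y :: "'b metric" and g
    assume "compact_space (mtopology_of Y) \<and> mspace Y \<noteq> {} \<and> homeomorphism_of Y g \<and>
        GH0_dist X Y f g < \<eta>"
    then have Y: "compact_space (mtopology_of Y)" "mspace Y \<noteq> {}" "homeomorphism_of Y g"
        "GH0_dist X Y f g < \<eta>" by auto
    obtain e :: "'b \<Rightarrow> real" where inj: "inj_on e (mspace Y)"
      using compact_metric_lepoll_reals[OF Y(1)] unfolding lepoll_def by blast
    define p where "p = inv_into (mspace Y) e"
    have pe: "p (e y) = y" if "y \<in> mspace Y" for y using inj that by (simp add: p_def)
    define M where "M = e ` mspace Y"
    define dd where "dd = (\<lambda>a b. mdist Y (p a) (p b))"
    have MS: "Metric_space M dd"
    proof
      show "0 \<le> dd x y" for x y by (simp add: dd_def)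
      show "dd x y = dd y x" for x y by (simp add: dd_def mdist_commute)
      show "dd x y = 0 \<longleftrightarrow> x = y" if "x \<in> M" "y \<in> M" for x y
        using that pe by (auto simp: M_def dd_def)
      show "dd x z \<le> dd x y + dd y z" if "x \<in> M" "y \<in> M" "z \<in> M" for x y z
        using that pe mdist_triangle by (auto simp: M_def dd_def)
    qed
    define Y' where "Y' = metric (M, dd)"
    have mY': "mspace Y' = M" and dY': "mdist Y' = dd"
      using MS by (simp_all add: Y'_def Metric_space.mspace_metric Metric_space.mdist_metric)
    have e: "e ` mspace Y = mspace Y'" by (simp add: mY' M_def)
    have p: "p ` mspace Y' = mspace Y" using pe by (force simp: mY' M_def)
    have d: "mdist Y' (e x) (e y) = mdist Y x y" if "x \<in> mspace Y" "y \<in> mspace Y" for x y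
      using that pe by (simp add: dY' dd_def)
    have ep: "e (p y) = y" if "y \<in> mspace Y'" for y using e pe that by force
    have d': "mdist Y (p x) (p y) = mdist Y' x y" if "x \<in> mspace Y'" "y \<in> mspace Y'" for x y
      by (simp add: dY' dd_def)
    have he: "homeomorphic_map (mtopology_of Y) (mtopology_of Y') e"
      unfolding mtopology_of_def
      by (intro Metric_space12.isometry_imp_homeomorphic_map Metric_space12.intro
           Metric_space_mspace_mdist e d) auto
    have hp: "homeomorphic_map (mtopology_of Y') (mtopology_of Y) p"
      unfolding mtopology_of_def
      by (intro Metric_space12.isometry_imp_homeomorphic_map Metric_space12.intro
           Metric_space_mspace_mdist p d') auto
    have hg: "homeomorphism_of Y' (e \<circ> g \<circ> p)"
      using he hp Y(3) unfolding homeomorphism_of_def by (meson homeomorphic_map_compose)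
    have gm: "g \<in> mspace Y \<rightarrow> mspace Y"
      using Y(3) unfolding homeomorphism_of_def
      by (metis homeomorphic_imp_surjective_map image_subset_iff_funcset order_refl topspace_mtopology_of)
    have "compact_space (mtopology_of Y')"
      using he Y(1) homeomorphic_compact_space homeomorphic_map_imp_homeomorphic_space by blast
    moreover have "mspace Y' \<noteq> {}" using e Y(2) by auto
    moreover have "GH0_dist X Y' f (e \<circ> g \<circ> p) < \<eta>"
      using GH0_dist_isometric[OF e p d pe gm f] Y(4) by simp
    ultimately obtain h where h: "continuous_map (mtopology_of Y') (mtopology_of X) h"
        "delta_isometry \<epsilon> Y' X h" "\<And>y. y\<in>mspace Y' \<Longrightarrow> f (h y) = h ((e \<circ> g \<circ> p) y)"
      using \<eta>[of Y' "e \<circ> g \<circ> p"] hg by metis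
    have "continuous_map (mtopology_of Y) (mtopology_of X) (h \<circ> e)"
      using h(1) he continuous_map_compose homeomorphic_imp_continuous_map by blast
    moreover have "delta_isometry \<epsilon> Y X (h \<circ> e)"
    proof -
      have "(h \<circ> e) ` mspace Y = h ` mspace Y'"
        using e by (metis image_comp)
      moreover have ee: "mspace Y' \<times> mspace Y' = map_prod e e ` (mspace Y \<times> mspace Y)"
        using e map_prod_surj_on by blast
      moreover have "(SUP (x, x') \<in> mspace Y' \<times> mspace Y'. \<bar>mdist X (h x) (h x') - mdist Y' x x'\<bar>)
          = (SUP (x, x') \<in> mspace Y \<times> mspace Y. \<bar>mdist X ((h \<circ> e) x) ((h \<circ> e) x') - mdist Y x x'\<bar>)"
        unfolding ee image_image using d by (intro SUP_cong refl) auto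
      moreover have "h \<circ> e \<in> mspace Y \<rightarrow> mspace X"
        using h(2) e[symmetric] unfolding delta_isometry_def by auto
      ultimately show ?thesis
        using h(2) unfolding delta_isometry_def by simp
    qed
    moreover have "f ((h \<circ> e) y) = (h \<circ> e) (g y)" if "y \<in> mspace Y" for y
      using h(3)[of "e y"] e pe that by auto
    ultimately show "\<exists>h. continuous_map (mtopology_of Y) (mtopology_of X) h \<and>
        delta_isometry \<epsilon> Y X h \<and> (\<forall>y\<in>mspace Y. f (h y) = h (g y))"
      by blast
  qed
qed

end

theory Submission
  imports Defs
begin

text \<open>
  Every orbit of a minimal homeomorphism \<open>f\<close> is forward recurrent, so for a point \<open>x\<close> there are
  arbitrarily fine orbit segments \<open>x, f x, \<dots>, f\<^sup>n\<^sup>-\<^sup>1 x\<close> for which \<open>f\<^sup>n x\<close> is close to \<open>x\<close>.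
  Sending the last point back to \<open>x\<close> turns such a segment into a cyclic permutation \<open>g\<close> of a finite
  space which is \<open>GH\<^sup>0\<close>-close to \<open>f\<close>. An equivariant map into \<open>X\<close> sends the cycle to a periodic
  orbit of \<open>f\<close>, which is excluded since a periodic orbit is finite, closed and invariant.
\<close>

section \<open>Upper bounds for the \<open>GH^0\<close> distance\<close>

lemma delta_isometryI:
  assumes "mspace X \<noteq> {}" and im: "i \<in> mspace X \<rightarrow> mspace Y" and "c < \<Delta>"
    and dense: "\<And>y. y \<in> mspace Y \<Longrightarrow> \<exists>x\<in>mspace X. mdist Y (i x) y \<le> c"
    and dist: "\<And>x x'. x \<in> mspace X \<Longrightarrow> x' \<in> mspace X \<Longrightarrow> \<bar>mdist Y (i x) (i x') - mdist X x x'\<bar> \<le> c"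
  shows "delta_isometry \<Delta> X Y i"
proof -
  have ne: "i ` mspace X \<noteq> {}" "mspace Y \<noteq> {}" using assms by auto
  have "c \<ge> 0" using dist assms(1) by fastforce
  have bdd: "bdd_below ((\<lambda>b. mdist Y a b) ` S)" "bdd_below ((\<lambda>b. mdist Y b a) ` S)" for a S
    by (auto intro: bdd_belowI2[where m = 0])
  have "(SUP a\<in>i ` mspace X. INF b\<in>mspace Y. mdist Y a b) \<le> c"
  proof (rule cSUP_least[OF ne(1)])
    fix a assume "a \<in> i ` mspace X"
    then have "a \<in> mspace Y" using im by blast
    then have "(INF b\<in>mspace Y. mdist Y a b) \<le> mdist Y a a" by (intro cINF_lower bdd)
    also have "mdist Y a a = 0" using \<open>a \<in> mspace Y\<close> by simp
    also note \<open>0 \<le> c\<close>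
    finally show "(INF b\<in>mspace Y. mdist Y a b) \<le> c" .
  qed
  moreover have "(SUP b\<in>mspace Y. INF a\<in>i ` mspace X. mdist Y a b) \<le> c"
  proof (rule cSUP_least[OF ne(2)])
    fix b assume "b \<in> mspace Y"
    then obtain x where "x \<in> mspace X" "mdist Y (i x) b \<le> c" using dense by blast
    then show "(INF a\<in>i ` mspace X. mdist Y a b) \<le> c"
      by (intro cINF_lower2[OF bdd(2)]) auto
  qed
  moreover have "(SUP (x, x') \<in> mspace X \<times> mspace X. \<bar>mdist Y (i x) (i x') - mdist X x x'\<bar>) \<le> c"
    using assms(1) dist by (intro cSUP_least) auto
  ultimately show ?thesis
    using im \<open>c < \<Delta>\<close> unfolding delta_isometry_def Hausdorff_dist_def by auto
qed

lemma uniform_dist_le: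
  assumes "mspace Z \<noteq> {}" and "\<And>z. z \<in> mspace Z \<Longrightarrow> mdist W (u z) (v z) \<le> c"
  shows "uniform_dist Z W u v \<le> c"
  unfolding uniform_dist_def using assms by (rule cSUP_least)

lemma GH0_dist_le:
  assumes "\<Delta> > 0" and "delta_isometry \<Delta> X Y i" and "delta_isometry \<Delta> Y X j"
    and "uniform_dist X Y (g \<circ> i) (i \<circ> f) < \<Delta>" and "uniform_dist Y X (j \<circ> g) (f \<circ> j) < \<Delta>"
  shows "GH0_dist X Y f g \<le> \<Delta>"
  unfolding GH0_dist_def using assms
  by (intro cInf_lower bdd_belowI[where m = 0]) auto

text \<open>The comparison maps are the inclusion of \<open>M\<close> into \<open>X\<close> and a
  map \<open>i\<close> that moves each point of \<open>X\<close> by less than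
  \<open>\<delta>\<close> into \<open>M\<close>. The largest error is \<open>3 * c\<close>, for the
  commutation of \<open>i\<close> with the dynamics; the factor 4 makes the inequalities
  strict.\<close>

lemma GH0_dist_dense_finite_subspace_le:
  assumes M: "M \<subseteq> mspace X" "M \<noteq> {}" "finite M" and gM: "g ` M = M"
    and f: "f \<in> mspace X \<rightarrow> mspace X"
    and "c > 0" "\<delta> > 0" "\<delta> \<le> c"
    and unif: "\<And>u v. u \<in> mspace X \<Longrightarrow> v \<in> mspace X \<Longrightarrow> mdist X u v < \<delta> \<Longrightarrow> mdist X (f u) (f v) \<le> c"
    and dense: "\<And>z. z \<in> mspace X \<Longrightarrow> \<exists>y\<in>M. mdist X z y < \<delta>"
    and gf: "\<And>y. y \<in> M \<Longrightarrow> mdist X (g y) (f y) \<le> c"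
  shows "GH0_dist X (submetric X M) f g \<le> 4 * c"
proof -
  let ?Y = "submetric X M"
  have Y: "mspace ?Y = M" using M by auto
  have X: "mspace X \<noteq> {}" using M by auto
  obtain i where i: "\<And>z. z \<in> mspace X \<Longrightarrow> i z \<in> M \<and> mdist X z (i z) < \<delta>"
    using dense by metis
  have iX: "i z \<in> mspace X" if "z \<in> mspace X" for z using i that M by blast
  show ?thesis
  proof (rule GH0_dist_le)
    show "delta_isometry (4 * c) X ?Y i"
    proof (rule delta_isometryI[where c = "2 * c", OF X])
      show "i \<in> mspace X \<rightarrow> mspace ?Y" using i Y by auto
      fix y assume "y \<in> mspace ?Y"
      then have y: "y \<in> mspace X" by auto
      then have "mdist X (i y) y \<le> 2 * c" using i[OF y] \<open>\<delta> \<le> c\<close> \<open>c > 0\<close> mdist_commute[of X y "i y"] by auto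
      then show "\<exists>x\<in>mspace X. mdist ?Y (i x) y \<le> 2 * c" using y by auto
    next
      \<comment> \<open>\<open>i\<close> moves each of the two points by at most \<open>c\<close>,
        so their distance changes by at most \<open>2 * c\<close>.\<close>
      fix x x' assume x: "x \<in> mspace X" "x' \<in> mspace X"
      have "mdist X x x' \<le> mdist X x (i x) + mdist X (i x) (i x') + mdist X (i x') x'"
        using mdist_triangle[of x X "i x" x'] mdist_triangle[of "i x" X "i x'" x'] x iX by fastforce
      moreover have "mdist X (i x) (i x') \<le> mdist X (i x) x + mdist X x x' + mdist X x' (i x')"
        using mdist_triangle[of "i x" X x "i x'"] mdist_triangle[of x X x' "i x'"] x iX by fastforce
      ultimately show "\<bar>mdist ?Y (i x) (i x') - mdist X x x'\<bar> \<le> 2 * c"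
        using i[OF x(1)] i[OF x(2)] \<open>\<delta> \<le> c\<close> mdist_commute[of X x "i x"] mdist_commute[of X x' "i x'"]
        by auto
    qed (use \<open>c > 0\<close> in auto)
    \<comment> \<open>The inclusion preserves distances exactly, so only the density of
      \<open>M\<close> contributes an error.\<close>
    show "delta_isometry (4 * c) ?Y X id"
    proof (rule delta_isometryI[where c = c])
      fix y assume y: "y \<in> mspace X"
      then obtain x where "x \<in> M" "mdist X y x < \<delta>" using dense by blast
      then show "\<exists>x\<in>mspace ?Y. mdist X (id x) y \<le> c"
        using \<open>\<delta> \<le> c\<close> M(1) mdist_commute[of X x y] by (intro bexI[of _ x]) auto
    qed (use M \<open>c > 0\<close> in auto)
    have "uniform_dist X ?Y (g \<circ> i) (i \<circ> f) \<le> 3 * c"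
    proof (rule uniform_dist_le[OF X])
      fix z assume z: "z \<in> mspace X"
      have fz: "f z \<in> mspace X" "f (i z) \<in> mspace X" "g (i z) \<in> mspace X"
        using f z iX[OF z] i[OF z] gM M(1) by blast+
      \<comment> \<open>Three errors of size \<open>c\<close>: replacing \<open>g\<close> by
        \<open>f\<close> at \<open>i z\<close>, moving \<open>i z\<close> back to \<open>z\<close>
        under the uniformly continuous \<open>f\<close>, and moving \<open>f z\<close> into
        \<open>M\<close>.\<close>
      have "mdist X (g (i z)) (i (f z)) \<le>
          mdist X (g (i z)) (f (i z)) + mdist X (f (i z)) (f z) + mdist X (f z) (i (f z))"
        using mdist_triangle[of "g (i z)" X "f (i z)" "i (f z)"]
          mdist_triangle[of "f (i z)" X "f z" "i (f z)"] fz iX[OF fz(1)] by linarith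
      also have "\<dots> \<le> c + c + c"
        using gf[of "i z"] i[OF z] i[OF fz(1)] unif[OF iX[OF z] z] \<open>\<delta> \<le> c\<close> mdist_commute[of X z "i z"]
        by (intro add_mono) auto
      finally show "mdist ?Y ((g \<circ> i) z) ((i \<circ> f) z) \<le> 3 * c" by simp
    qed
    then show "uniform_dist X ?Y (g \<circ> i) (i \<circ> f) < 4 * c" using \<open>c > 0\<close> by linarith
    have "uniform_dist ?Y X (id \<circ> g) (f \<circ> id) \<le> c"
      using M Y gf by (intro uniform_dist_le) auto
    then show "uniform_dist ?Y X (id \<circ> g) (f \<circ> id) < 4 * c" using \<open>c > 0\<close> by linarith
  qed (use \<open>c > 0\<close> in auto)
qed

section \<open>Finite metric spaces\<close>

lemma Hausdorff_space_mtopology_of: "Hausdorff_space (mtopology_of X)"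
  by (simp add: mtopology_of_def Metric_space.Hausdorff_space_mtopology)

lemma mtopology_of_finite:
  assumes "finite (mspace Y)"
  shows "mtopology_of Y = discrete_topology (mspace Y)"
  using assms by (intro finite_topspace_imp_discrete_topology Hausdorff_space_mtopology_of) simp_all

text \<open>The topology is discrete, and a map of a finite set onto itself is injective.\<close>

lemma homeomorphism_of_finite:
  assumes "finite (mspace Y)" and "g ` mspace Y = mspace Y"
  shows "homeomorphism_of Y g"
  unfolding homeomorphism_of_def mtopology_of_finite[OF assms(1)]
  using assms
  by (intro bijective_closed_imp_homeomorphic_map)
    (auto simp: closed_map_def finite_surj_inj)

section \<open>Orbits of minimal homeomorphisms\<close>

lemma funpow_mem:
  assumes "f \<in> A \<rightarrow> A" and "x \<in> A"
  shows "(f ^^ n) x \<in> A"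
  using assms by (induction n) auto

lemma homeomorphism_of_funcset:
  assumes "homeomorphism_of X f"
  shows "f \<in> mspace X \<rightarrow> mspace X"
  using homeomorphic_imp_surjective_map[OF assms[unfolded homeomorphism_of_def]] by auto

lemma minimal_map_no_periodic_point:
  assumes "minimal_map X f" and "infinite (mspace X)" and f: "f \<in> mspace X \<rightarrow> mspace X"
    and x: "x \<in> mspace X" and "n > 0"
  shows "(f ^^ n) x \<noteq> x"
proof
  assume per: "(f ^^ n) x = x"
  let ?P = "(\<lambda>k. (f ^^ k) x) ` {..<n}"
  have "f ` ?P = ?P"
  proof -
    have "f ` ?P = (\<lambda>k. (f ^^ k) x) ` (Suc ` {..<n})" by (simp add: image_image)
    \<comment> \<open>Applying \<open>f\<close> shifts the indices to 1 up to \<open>n\<close>; by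
      periodicity index \<open>n\<close> gives the same point as index 0, so the orbit is mapped
      onto itself.\<close>
    also have "Suc ` {..<n} = {1..<n} \<union> {n}" using \<open>n > 0\<close>
      by (simp add: image_Suc_lessThan) (use atLeastLessThanSuc_atLeastAtMost in force)
    also have "(\<lambda>k. (f ^^ k) x) ` \<dots> = (\<lambda>k. (f ^^ k) x) ` ({1..<n} \<union> {0})"
      using per by simp
    also have "{1..<n} \<union> {0} = {..<n}" using \<open>n > 0\<close> by auto
    finally show ?thesis .
  qed
  moreover have "closedin (mtopology_of X) ?P"
    using funpow_mem[OF f x] by (intro closedin_Hausdorff_finite Hausdorff_space_mtopology_of) auto
  moreover have "?P \<noteq> {}" using \<open>n > 0\<close> by auto
  ultimately have "?P = mspace X" using assms(1) unfolding minimal_map_def by blast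
  then show False using assms(2) by (metis finite_imageI finite_lessThan)
qed

text \<open>The omega-limit set of \<open>x\<close>, the intersection of the closures
  \<open>C N\<close> of the orbit tails, is closed, nonempty by compactness, and invariant. By
  minimality it is all of \<open>X\<close>, so \<open>z\<close> lies in the closure of every
  tail.\<close>

lemma minimal_map_forward_tail_dense:
  assumes comp: "compact_space (mtopology_of X)" and hom: "homeomorphism_of X f"
    and "minimal_map X f" and x: "x \<in> mspace X" and z: "z \<in> mspace X" and "e > 0"
  shows "\<exists>k\<ge>N. mdist X z ((f ^^ k) x) < e"
proof -
  interpret Metric_space "mspace X" "mdist X" by (rule Metric_space_mspace_mdist)
  note f = homeomorphism_of_funcset[OF hom]
  define A where "A = (\<lambda>N. (\<lambda>k. (f ^^ k) x) ` {N..})"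
  define C where "C = (\<lambda>N. mtopology_of X closure_of A N)"
  have A: "A N \<subseteq> mspace X" for N using funpow_mem[OF f x] by (auto simp: A_def)
  have C: "C N \<subseteq> mspace X" for N
    unfolding C_def by (metis closure_of_subset_topspace topspace_mtopology_of)
  have decA: "A n \<subseteq> A m" if "m \<le> n" for m n using that by (auto simp: A_def)
  have dec: "C n \<subseteq> C m" if "m \<le> n" for m n
    unfolding C_def by (rule closure_of_mono[OF decA[OF that]])
  have ne: "C n \<noteq> {}" for n
    using A closure_of_subset[of "A n" "mtopology_of X"] by (auto simp: C_def A_def)
  have "(\<Inter>n. C n) \<noteq> {}"
    using dec ne by (intro compact_space_imp_nest[OF comp]) (auto simp: C_def antimono_def)
  moreover have "closedin (mtopology_of X) (\<Inter>n. C n)"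
    by (intro closedin_Inter) (auto simp: C_def)
  moreover have "f ` (\<Inter>n. C n) = (\<Inter>n. C n)"
  proof -
    have fC: "f ` C n = C (Suc n)" for n
    proof -
      have "f ` A n = (\<lambda>k. (f ^^ k) x) ` (Suc ` {n..})" by (simp add: A_def image_image)
      also have "Suc ` {n..} = {Suc n..}" by (auto dest: Suc_le_D)
      finally have "f ` A n = A (Suc n)" by (simp add: A_def)
      then show ?thesis
        unfolding C_def using homeomorphic_map_closure_of[OF hom[unfolded homeomorphism_of_def], of "A n"] A
        by simp
    qed
    \<comment> \<open>Injectivity lets \<open>f\<close> commute with the intersection; then
      \<open>f\<close> only drops the first member of the decreasing sequence
      \<open>C\<close>.\<close>
    have "inj_on f (mspace X)"
      using homeomorphic_imp_injective_map[OF hom[unfolded homeomorphism_of_def]] by simp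
    then have "f ` (\<Inter>n. C n) = (\<Inter>n. f ` C n)"
      using C by (intro image_INT) auto
    also have "\<dots> = (\<Inter>n. C n)" using dec[OF le_SucI[OF order_refl]] unfolding fC by blast
    finally show ?thesis .
  qed
  ultimately have "(\<Inter>n. C n) = mspace X"
    by (intro assms(3)[unfolded minimal_map_def, rule_format] conjI)
  then have "z \<in> C N" using z by blast
  then have "\<exists>y\<in>A N. y \<in> mball z e"
    using \<open>e > 0\<close> by (simp add: C_def mtopology_of_def metric_closure_of)
  then show ?thesis by (auto simp: A_def)
qed

text \<open>By total boundedness it suffices that the orbit visits finitely many net points up to
  \<open>e / 2\<close>. After the last of these visits, a later return close to \<open>x\<close>
  ends the segment.\<close>

lemma minimal_map_almost_periodic_dense_segment:
  assumes comp: "compact_space (mtopology_of X)" and hom: "homeomorphism_of X f"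
    and min: "minimal_map X f" and x: "x \<in> mspace X" and "e > 0"
  shows "\<exists>n>0. mdist X x ((f ^^ n) x) < e \<and> (\<forall>z\<in>mspace X. \<exists>k<n. mdist X z ((f ^^ k) x) < e)"
proof -
  interpret Metric_space "mspace X" "mdist X" by (rule Metric_space_mspace_mdist)
  have "mtotally_bounded (mspace X)"
    using comp compactin_imp_mtotally_bounded
    by (metis compact_space_def mtopology_of_def topspace_mtopology_of)
  then obtain K where K: "finite K" "K \<subseteq> mspace X" "mspace X \<subseteq> (\<Union>y\<in>K. mball y (e / 2))"
    using \<open>e > 0\<close> unfolding mtotally_bounded_def by (meson half_gt_zero)
  have "\<exists>k. mdist X y ((f ^^ k) x) < e / 2" if "y \<in> K" for y
    using minimal_map_forward_tail_dense[OF comp hom min x, of y "e / 2" 0] K(2) that \<open>e > 0\<close> by auto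
  then obtain k where k: "\<And>y. y \<in> K \<Longrightarrow> mdist X y ((f ^^ k y) x) < e / 2" by metis
  obtain N where N: "\<And>y. y \<in> K \<Longrightarrow> k y < N"
    using K(1) finite_nat_set_iff_bounded[of "k ` K"] by auto
  \<comment> \<open>\<open>Suc N\<close> makes \<open>n\<close> positive and larger than all
    visiting times \<open>k y\<close>.\<close>
  obtain n where n: "n \<ge> Suc N" "mdist X x ((f ^^ n) x) < e"
    using minimal_map_forward_tail_dense[OF comp hom min x x \<open>e > 0\<close>] by blast
  have "\<exists>k<n. mdist X z ((f ^^ k) x) < e" if z: "z \<in> mspace X" for z
  proof -
    obtain y where y: "y \<in> K" "mdist X y z < e / 2" using K(3) z by auto
    have "mdist X z ((f ^^ k y) x) \<le> mdist X z y + mdist X y ((f ^^ k y) x)"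
      using y K(2) z funpow_mem[OF homeomorphism_of_funcset[OF hom] x] by (intro triangle) auto
    then have "mdist X z ((f ^^ k y) x) < e"
      using y k[OF y(1)] commute[of y z] by simp
    then show ?thesis using N[OF y(1)] n(1) by (intro exI[of _ "k y"]) auto
  qed
  then show ?thesis using n by (intro exI[of _ n]) auto
qed

section \<open>The closed-up orbit segment and the resulting periodic point\<close>

theorem corollary4p3:
  fixes X :: "'a metric" and f :: "'a \<Rightarrow> 'a"
  assumes "compact_space (mtopology_of X)" and "infinite (mspace X)"
    and "homeomorphism_of X f" and "minimal_map X f"
  shows "\<not> topologically_GH_stable X f"
proof
  assume stable: "topologically_GH_stable X f"
  note f = homeomorphism_of_funcset[OF assms(3)]
  note noper = minimal_map_no_periodic_point[OF assms(4,2) f]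
  \<comment> \<open>Stability is transferred from real carriers to type \<open>'a\<close>, so that
    \<open>Y\<close> can be a subspace of \<open>X\<close>. Any positive value serves for
    \<epsilon>; 1 is taken.\<close>
  obtain \<eta> where "\<eta> > 0" and \<eta>: "\<And>(Y :: 'a metric) g.
      compact_space (mtopology_of Y) \<Longrightarrow> mspace Y \<noteq> {} \<Longrightarrow> homeomorphism_of Y g \<Longrightarrow>
      GH0_dist X Y f g < \<eta> \<Longrightarrow>
      (\<exists>h. continuous_map (mtopology_of Y) (mtopology_of X) h \<and> delta_isometry 1 Y X h \<and>
           (\<forall>y\<in>mspace Y. f (h y) = h (g y)))"
    using topologically_GH_stable_any_type[OF stable f, of 1] by (metis zero_less_one)
  \<comment> \<open>The bound \<open>4 * c\<close> for the distance becomes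
    \<open>\<eta> / 2\<close>.\<close>
  define c where "c = \<eta> / 8"
  have "c > 0" using \<open>\<eta> > 0\<close> by (simp add: c_def)
  have "uniformly_continuous_map X X f"
    using assms(1,3) continuous_imp_uniformly_continuous_map homeomorphic_imp_continuous_map
    unfolding homeomorphism_of_def by blast
  then obtain \<delta>0 where "\<delta>0 > 0" and \<delta>0: "\<And>u v. u \<in> mspace X \<Longrightarrow> v \<in> mspace X \<Longrightarrow>
      mdist X u v < \<delta>0 \<Longrightarrow> mdist X (f u) (f v) < c"
    unfolding uniformly_continuous_map_def using \<open>c > 0\<close> by metis
  define \<delta> where "\<delta> = min \<delta>0 c"
  have \<delta>: "\<delta> > 0" "\<delta> \<le> c" "\<delta> \<le> \<delta>0" using \<open>\<delta>0 > 0\<close> \<open>c > 0\<close> by (auto simp: \<delta>_def)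
  obtain x where x: "x \<in> mspace X" using assms(2) by fastforce
  obtain n where "n > 0" and ret: "mdist X x ((f ^^ n) x) < \<delta>"
    and dense: "\<And>z. z \<in> mspace X \<Longrightarrow> \<exists>k<n. mdist X z ((f ^^ k) x) < \<delta>"
    using minimal_map_almost_periodic_dense_segment[OF assms(1,3,4) x \<delta>(1)] by blast
  define p where "p = (\<lambda>k. (f ^^ k) x)"
  have p: "p k \<in> mspace X" for k unfolding p_def by (rule funpow_mem[OF f x])
  \<comment> \<open>A coincidence \<open>p j = p k\<close> with \<open>j < k\<close> would make
    \<open>p j\<close> periodic with period \<open>k - j\<close>.\<close>
  have inj: "inj p"
  proof (rule linorder_injI)
    fix j k :: nat assume "j < k"
    have "p k = (f ^^ (k - j)) (p j)"
      using \<open>j < k\<close> by (simp add: p_def flip: funpow_add comp_apply[of "f ^^ (k - j)" "f ^^ j"])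
    then show "p j \<noteq> p k" using noper[OF p[of j], of "k - j"] \<open>j < k\<close> by auto
  qed
  define M where "M = p ` {..<n}"
  define g where "g = (\<lambda>y. if y = p (n - 1) then x else f y)"
  \<comment> \<open>Since \<open>p\<close> is injective, the test on points in \<open>g\<close>
    becomes a test on indices.\<close>
  have gp: "g (p k) = (if k = n - 1 then p 0 else p (Suc k))" for k
  proof -
    have "p 0 = x" "f (p k) = p (Suc k)" by (simp_all add: p_def)
    then show ?thesis by (simp add: g_def inj_eq[OF inj])
  qed
  \<comment> \<open>An injective map of the finite set \<open>M\<close> into itself is onto, by
    cardinality.\<close>
  have gM: "g ` M = M"
  proof (rule card_subset_eq)
    show sub: "g ` M \<subseteq> M" using \<open>n > 0\<close> gp by (auto simp: M_def)
    have "inj_on g M"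
      unfolding M_def using inj by (auto simp: inj_on_def gp dest: injD split: if_splits)
    then show "card (g ` M) = card M" by (rule card_image)
  qed (simp add: M_def)
  let ?Y = "submetric X M"
  have Y: "mspace ?Y = M" using p by (auto simp: M_def)
  have finY: "finite (mspace ?Y)" unfolding Y by (simp add: M_def)
  have "GH0_dist X ?Y f g \<le> 4 * c"
  proof (rule GH0_dist_dense_finite_subspace_le[OF _ _ _ gM f \<open>c > 0\<close> \<delta>(1,2)])
    show "M \<subseteq> mspace X" "M \<noteq> {}" "finite M" using p \<open>n > 0\<close> by (auto simp: M_def)
    show "mdist X (f u) (f v) \<le> c" if "u \<in> mspace X" "v \<in> mspace X" "mdist X u v < \<delta>" for u v
      using \<delta>0[OF that(1,2)] that(3) \<delta>(3) by simp
    show "\<exists>y\<in>M. mdist X z y < \<delta>" if "z \<in> mspace X" for z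
      using dense[OF that] by (auto simp: M_def p_def)
    fix y assume "y \<in> M"
    then obtain k where k: "y = p k" "k < n" by (auto simp: M_def)
    have fy: "f y = p (Suc k)" by (simp add: k p_def)
    show "mdist X (g y) (f y) \<le> c"
    proof (cases "k = n - 1")
      \<comment> \<open>Only at the last point can \<open>g\<close> and \<open>f\<close> differ:
        \<open>f\<close> leads to \<open>p n\<close>, which is within \<open>\<delta>\<close> of
        \<open>p 0\<close> by the choice of \<open>n\<close>.\<close>
      case True
      then have "g y = p 0" "f y = p n" using \<open>n > 0\<close> by (simp add: k(1) gp, simp add: fy)
      then show ?thesis using ret \<delta>(2) by (simp add: p_def)
    next
      case False
      then have "g y = f y" unfolding fy by (simp add: k(1) gp)
      then have "mdist X (g y) (f y) = 0" using p fy by simp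
      then show ?thesis using \<open>c > 0\<close> by simp
    qed
  qed
  also have "\<dots> < \<eta>" using \<open>\<eta> > 0\<close> by (simp add: c_def)
  finally have "GH0_dist X ?Y f g < \<eta>" .
  moreover have "compact_space (mtopology_of ?Y)"
    unfolding mtopology_of_finite[OF finY] using finY by (simp add: compact_space_discrete_topology)
  moreover have "mspace ?Y \<noteq> {}" using \<open>n > 0\<close> unfolding Y by (auto simp: M_def)
  moreover have "homeomorphism_of ?Y g" using homeomorphism_of_finite[OF finY] gM unfolding Y by simp
  ultimately obtain h where h: "delta_isometry 1 ?Y X h" "\<And>y. y \<in> M \<Longrightarrow> f (h y) = h (g y)"
    using \<eta>[of ?Y g] unfolding Y by metis
  \<comment> \<open>Below index \<open>n - 1\<close> the map \<open>g\<close> shifts indices by one,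
    so equivariance carries the segment to an orbit segment of \<open>f\<close>.\<close>
  have hp: "(f ^^ k) (h (p 0)) = h (p k)" if "k < n" for k
    using that
  proof (induction k)
    case (Suc k)
    then have "p k \<in> M" "k \<noteq> n - 1" by (auto simp: M_def)
    then show ?case using Suc h(2)[of "p k"] by (simp add: gp)
  qed simp
  have "p (n - 1) \<in> M" "p 0 \<in> M" using \<open>n > 0\<close> by (auto simp: M_def)
  have "(f ^^ n) (h (p 0)) = f ((f ^^ (n - 1)) (h (p 0)))"
    using \<open>n > 0\<close> by (cases n) auto
  \<comment> \<open>The last application of \<open>f\<close> wraps around, because
    \<open>g (p (n - 1)) = p 0\<close>.\<close>
  also have "\<dots> = h (p 0)"
    using hp[of "n - 1"] h(2)[OF \<open>p (n - 1) \<in> M\<close>] \<open>n > 0\<close> by (simp add: gp)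
  finally have "(f ^^ n) (h (p 0)) = h (p 0)" .
  moreover have "h (p 0) \<in> mspace X"
    using h(1) \<open>p 0 \<in> M\<close> unfolding delta_isometry_def Y by blast
  ultimately show False using noper \<open>n > 0\<close> by blast
qed

end
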